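(* Let $\succ$ be an irreflexive, transitive and strongly monotonic binary relation on $\mathbb{R}_+^n$. Then the following are equivalent: $\succ$ is Archimedean; $\succ$ is strict-Archimedean; $\succ$ has open sections.
   Context: For vectors, $x>y$ means $x_i\ge y_i$ for every $i$ and $x\ne y$. Strongly monotonic: for all $x,y\in\mathbb{R}^n_+$, $x>y$ implies $x\succ y$. For $\lambda\in[0,1]$, $x\lambda y=\lambda x+(1-\lambda)y$. Archimedean: for all $x,y,z\in\mathbb{R}_+^n$ with $x\succ y$ there exist $\lambda,\delta\in(0,1)$ with $x\lambda z\succ y$ and $x\succ y\delta z$. Strict-Archimedean: for all $x,y,z\in\mathbb{R}_+^n$, the sets $\{\lambda\in[0,1]:x\lambda y\succ z\}$ and $\{\lambda\in[0,1]:z\succ x\lambda y\}$ are open in $[0,1]$. Open sections: for all $x\in\mathbb{R}_+^n$, the sets $\{y\in\mathbb{R}_+^n:y\succ x\}$ and $\{y\in\mathbb{R}_+^n:x\succ y\}$ are open in $\mathbb{R}_+^n$. *)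

theory Defs
  imports "HOL-Analysis.Analysis"
begin

definition orthant :: "(real ^ 'n) set" where
  "orthant = {x. \<forall>i. 0 \<le> x $ i}"

text \<open>The library order on vectors is componentwise, and its strict part is
  componentwise \<open>\<ge>\<close> together with \<open>\<noteq>\<close> (not strict inequality in every component).\<close>

lemma vec_greater_iff:
  fixes x y :: "real ^ 'n"
  shows "x > y \<longleftrightarrow> (\<forall>i. x $ i \<ge> y $ i) \<and> x \<noteq> y"
  by (auto simp: order_less_le less_eq_vec_def)

text \<open>A relation on the orthant is a binary predicate on all vectors; every property below
  only inspects its values on the orthant.\<close>

definition strongly_monotonic :: "(real ^ 'n \<Rightarrow> real ^ 'n \<Rightarrow> bool) \<Rightarrow> bool" where
  "strongly_monotonic R \<longleftrightarrow> (\<forall>x\<in>orthant. \<forall>y\<in>orthant. x > y \<longrightarrow> R x y)"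

definition mix :: "real ^ 'n \<Rightarrow> real \<Rightarrow> real ^ 'n \<Rightarrow> real ^ 'n" where
  "mix x l y = l *\<^sub>R x + (1 - l) *\<^sub>R y"

definition archimedean :: "(real ^ 'n \<Rightarrow> real ^ 'n \<Rightarrow> bool) \<Rightarrow> bool" where
  "archimedean R \<longleftrightarrow>
    (\<forall>x\<in>orthant. \<forall>y\<in>orthant. \<forall>z\<in>orthant. R x y \<longrightarrow>
      (\<exists>l\<in>{0<..<1}. \<exists>d\<in>{0<..<1}. R (mix x l z) y \<and> R x (mix y d z)))"

definition strict_archimedean :: "(real ^ 'n \<Rightarrow> real ^ 'n \<Rightarrow> bool) \<Rightarrow> bool" where
  "strict_archimedean R \<longleftrightarrow>
    (\<forall>x\<in>orthant. \<forall>y\<in>orthant. \<forall>z\<in>orthant.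
      openin (top_of_set {0..1}) {l\<in>{0..1}. R (mix x l y) z} \<and>
      openin (top_of_set {0..1}) {l\<in>{0..1}. R z (mix x l y)})"

definition open_sections :: "(real ^ 'n \<Rightarrow> real ^ 'n \<Rightarrow> bool) \<Rightarrow> bool" where
  "open_sections R \<longleftrightarrow>
    (\<forall>x\<in>orthant.
      openin (top_of_set orthant) {y\<in>orthant. R y x} \<and>
      openin (top_of_set orthant) {y\<in>orthant. R x y})"

end

theory Submission
  imports Defs
begin

text \<open>Monotonicity reduces open sections to mixtures with two special points. If \<open>x \<succ> y\<close>, mixing
  \<open>x\<close> with \<open>0\<close> gives \<open>l x \<succ> y\<close> for some \<open>l < 1\<close>, and the points of the orthant above \<open>l x\<close> form
  a neighbourhood of \<open>x\<close> relative to the orthant, even if \<open>x\<close> lies on its boundary. Mixing \<open>y\<close>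
  with \<open>y + 1\<close> gives \<open>x \<succ> y + (1 - d) 1\<close> for some \<open>d < 1\<close>, and the points below
  \<open>y + (1 - d) 1\<close> form a neighbourhood of \<open>y\<close>.\<close>

lemma mix_1 [simp]: "mix x 1 y = x"
  by (simp add: mix_def)

lemma mix_in_orthant:
  assumes "x \<in> orthant" "y \<in> orthant" "l \<in> {0..1}"
  shows "mix x l y \<in> orthant"
  using assms by (auto simp: mix_def orthant_def)

text \<open>The neighbourhoods built below yield only weak inequalities, and equality can occur (for
  instance at the origin), where strong monotonicity is silent. The equal case is therefore split
  off; otherwise transitivity through \<open>u\<close> applies.\<close>

lemma R_mono_left:
  assumes "transp_on orthant R" "strongly_monotonic R"
    and "w \<in> orthant" "u \<in> orthant" "y \<in> orthant" "u \<le> w" "R u y"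
  shows "R w y"
proof (cases "w = u")
  case False
  then have "R w u"
    using assms by (auto simp: strongly_monotonic_def)
  then show ?thesis
    using assms by (blast dest: transp_onD)
qed (use assms in simp)

lemma R_mono_right:
  assumes "transp_on orthant R" "strongly_monotonic R"
    and "x \<in> orthant" "u \<in> orthant" "w \<in> orthant" "w \<le> u" "R x u"
  shows "R x w"
proof (cases "w = u")
  case False
  then have "R u w"
    using assms by (auto simp: strongly_monotonic_def)
  then show ?thesis
    using assms by (blast dest: transp_onD)
qed (use assms in simp)

lemma archimedean_imp_open_sections:
  fixes R :: "real ^ 'n \<Rightarrow> real ^ 'n \<Rightarrow> bool"
  assumes R: "transp_on orthant R" "strongly_monotonic R" and arch: "archimedean R"
  shows "open_sections R"
  unfolding open_sections_def
proof (intro ballI conjI)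
  fix y :: "real ^ 'n"
  assume y: "y \<in> orthant"
  show "openin (top_of_set orthant) {x \<in> orthant. R x y}"
  proof (subst openin_subopen, clarify)
    fix x :: "real ^ 'n"
    assume x: "x \<in> orthant" and xy: "R x y"
    have "0 \<in> (orthant :: (real ^ 'n) set)"
      by (simp add: orthant_def)
    then obtain l where "l \<in> {0<..<1}" and lxy: "R (mix x l 0) y"
      using arch x y xy unfolding archimedean_def by blast
    then have l: "0 < l" "l < 1"
      by simp_all
    \<comment> \<open>Only positive coordinates are constrained: where \<open>x $ i = 0\<close> the
      strict inequality would exclude \<open>x\<close> itself, while membership in the orthant
      already gives \<open>w $ i\<close> \<ge> 0 = \<open>l * x $ i\<close>. \<open>V\<close> is
      open as an intersection over finitely many coordinates.\<close>
    define V where "V = (\<Inter>i\<in>{i. x $ i > 0}. {w :: real ^ 'n. l * x $ i < w $ i})"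
    have "open V"
      unfolding V_def by (intro open_INT ballI open_Collect_less continuous_intros) auto
    moreover have "x \<in> V"
      using l by (simp add: V_def)
    moreover have "orthant \<inter> V \<subseteq> {x \<in> orthant. R x y}"
    proof clarify
      fix w :: "real ^ 'n"
      assume w: "w \<in> orthant" "w \<in> V"
      have "l * x $ i \<le> w $ i" for i
      proof (cases "x $ i > 0")
        case True
        then show ?thesis using w by (auto simp: V_def less_imp_le)
      next
        case False
        then have "x $ i = 0"
          using x by (auto simp: orthant_def not_less intro: antisym)
        then show ?thesis using w by (simp add: orthant_def)
      qed
      then have "mix x l 0 \<le> w"
        by (simp add: mix_def less_eq_vec_def)
      moreover have "mix x l 0 \<in> orthant"
        using x l by (simp add: mix_def orthant_def)
      ultimately show "R w y"
        using R_mono_left[OF R] w y lxy by blast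
    qed
    ultimately show "\<exists>T. openin (top_of_set orthant) T \<and> x \<in> T \<and> T \<subseteq> {x \<in> orthant. R x y}"
      using x openin_open_Int by blast
  qed
next
  fix x :: "real ^ 'n"
  assume x: "x \<in> orthant"
  show "openin (top_of_set orthant) {y \<in> orthant. R x y}"
  proof (subst openin_subopen, clarify)
    fix y :: "real ^ 'n"
    assume y: "y \<in> orthant" and xy: "R x y"
    have y1: "y + 1 \<in> orthant"
      using y by (simp add: orthant_def)
    then obtain d where "d \<in> {0<..<1}" and xd: "R x (mix y d (y + 1))"
      using arch x y xy unfolding archimedean_def by blast
    then have d: "0 < d" "d < 1"
      by simp_all
    \<comment> \<open>Here every coordinate can be constrained strictly, because the mixture exceeds
      \<open>y\<close> by \<open>1 - d\<close> > 0 in each of them, zero coordinates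
      included.\<close>
    define V where "V = (\<Inter>i. {w :: real ^ 'n. w $ i < mix y d (y + 1) $ i})"
    have mix_nth: "mix y d (y + 1) $ i = y $ i + (1 - d)" for i
      by (simp add: mix_def algebra_simps)
    have "open V"
      unfolding V_def by (intro open_INT ballI open_Collect_less continuous_intros) auto
    moreover have "y \<in> V"
      using d by (simp add: V_def mix_nth)
    moreover have "orthant \<inter> V \<subseteq> {y \<in> orthant. R x y}"
    proof clarify
      fix w :: "real ^ 'n"
      assume w: "w \<in> orthant" "w \<in> V"
      then have "w \<le> mix y d (y + 1)"
        by (simp add: V_def less_eq_vec_def less_imp_le)
      moreover have "mix y d (y + 1) \<in> orthant"
        using y y1 d by (auto intro!: mix_in_orthant)
      ultimately show "R x w"
        using R_mono_right[OF R] w x xd by blast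
    qed
    ultimately show "\<exists>T. openin (top_of_set orthant) T \<and> y \<in> T \<and> T \<subseteq> {y \<in> orthant. R x y}"
      using y openin_open_Int by blast
  qed
qed

text \<open>The segment \<open>l\<close> \<mapsto> \<open>mix x l y\<close> is a continuous map from
  the unit interval into the orthant, so both sets of weights are preimages of relatively open
  sections at \<open>z\<close>.\<close>

lemma open_sections_imp_strict_archimedean:
  fixes R :: "real ^ 'n \<Rightarrow> real ^ 'n \<Rightarrow> bool"
  assumes "open_sections R"
  shows "strict_archimedean R"
  unfolding strict_archimedean_def
proof (intro ballI)
  fix x y z :: "real ^ 'n"
  assume xyz: "x \<in> orthant" "y \<in> orthant" "z \<in> orthant"
  let ?f = "\<lambda>l. mix x l y"
  have cont: "continuous_on {0..1} ?f"
    unfolding mix_def by (intro continuous_intros)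
  have maps: "?f \<in> {0..1} \<rightarrow> orthant"
    using xyz mix_in_orthant by blast
  have preimage: "openin (top_of_set {0..1}) {l \<in> {0..1}. P (?f l)}"
    if "openin (top_of_set orthant) {w \<in> orthant. P w}" for P
  proof -
    have "{l \<in> {0..1}. P (?f l)} = {0..1} \<inter> ?f -` {w \<in> orthant. P w}"
      using maps by auto
    then show ?thesis
      using continuous_openin_preimage[OF cont maps that] by simp
  qed
  show "openin (top_of_set {0..1}) {l \<in> {0..1}. R (?f l) z} \<and>
        openin (top_of_set {0..1}) {l \<in> {0..1}. R z (?f l)}"
    using assms xyz preimage[of "\<lambda>w. R w z"] preimage[of "R z"]
    by (simp add: open_sections_def)
qed

lemma openin_unit_interval_1_imp_interior:
  fixes A :: "real set"
  assumes "openin (top_of_set {0..1}) A" "1 \<in> A"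
  obtains l where "l \<in> {0<..<1}" "l \<in> A"
proof -
  obtain e where e: "e > 0" "\<And>l. l \<in> {0..1} \<Longrightarrow> dist l 1 < e \<Longrightarrow> l \<in> A"
    using assms unfolding openin_euclidean_subtopology_iff by blast
  show thesis
    \<comment> \<open>The term \<open>1 - e / 2\<close> stays within \<open>e\<close> of 1; the
      maximum with 1/2 keeps the weight positive when \<open>e\<close> is large.\<close>
    by (rule that[of "max (1 / 2) (1 - e / 2)"]) (use e in \<open>auto simp: dist_real_def max_def\<close>)
qed

text \<open>Weight 1 returns the first point of a mixture, so \<open>R x y\<close> puts 1 into both
  relatively open sets of weights, and each then contains a weight strictly between 0 and 1.\<close>

lemma strict_archimedean_imp_archimedean:
  fixes R :: "real ^ 'n \<Rightarrow> real ^ 'n \<Rightarrow> bool"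
  assumes "strict_archimedean R"
  shows "archimedean R"
  unfolding archimedean_def
proof (intro ballI impI)
  fix x y z :: "real ^ 'n"
  assume xyz: "x \<in> orthant" "y \<in> orthant" "z \<in> orthant" and "R x y"
  have "openin (top_of_set {0..1}) {l \<in> {0..1}. R (mix x l z) y}"
    using assms xyz by (simp add: strict_archimedean_def)
  then obtain l where "l \<in> {0<..<1}" "R (mix x l z) y"
    by (rule openin_unit_interval_1_imp_interior) (use \<open>R x y\<close> in auto)
  have "openin (top_of_set {0..1}) {d \<in> {0..1}. R x (mix y d z)}"
    using assms xyz by (simp add: strict_archimedean_def)
  then obtain d where "d \<in> {0<..<1}" "R x (mix y d z)"
    by (rule openin_unit_interval_1_imp_interior) (use \<open>R x y\<close> in auto)
  with \<open>l \<in> {0<..<1}\<close> \<open>R (mix x l z) y\<close>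
  show "\<exists>l\<in>{0<..<1}. \<exists>d\<in>{0<..<1}. R (mix x l z) y \<and> R x (mix y d z)"
    by blast
qed

theorem proposition6:
  fixes R :: "real ^ 'n \<Rightarrow> real ^ 'n \<Rightarrow> bool"
  assumes "irreflp_on orthant R"
    and "transp_on orthant R"
    and "strongly_monotonic R"
  shows "(archimedean R \<longleftrightarrow> strict_archimedean R) \<and>
         (strict_archimedean R \<longleftrightarrow> open_sections R)"
  \<comment> \<open>The three implications form a cycle: Archimedean, open sections,
    strict-Archimedean, and back.\<close>
  using archimedean_imp_open_sections[OF assms(2,3)] open_sections_imp_strict_archimedean
    strict_archimedean_imp_archimedean by blast

end
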